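(* Let $e_0=(3-\sqrt3)/6\approx 0.2113$. For every fixed $e$ with $0<e<e_0$ there is $\sigma_0>0$ such that for all $\sigma\in(0,\sigma_0)$ the symmetric bipodal graphon $$g(x,y)=\begin{cases} e-\sigma, & 0<x,y<\tfrac12\ \text{ or }\ \tfrac12<x,y<1,\\ e+\sigma, & x<\tfrac12<y\ \text{ or }\ y<\tfrac12<x,\end{cases}$$ does not maximize $S$ among graphons with edge density $e$ and triangle density $t=e^3-\sigma^3$.
   Context: A graphon is a measurable symmetric function $g:[0,1]^2\to[0,1]$. Its edge density is $\iint g(x,y)\,dx\,dy$, its triangle density is $\iiint g(x,y)g(y,z)g(z,x)\,dx\,dy\,dz$, and its entropy is $S(g)=\iint H[g(x,y)]\,dx\,dy$, where $H(u)=-[u\ln u+(1-u)\ln(1-u)]$ for $u\in[0,1]$ (with $0\ln0=0$). *)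

theory Defs
  imports "HOL-Analysis.Analysis"
begin

abbreviation unit_square :: "(real \<times> real) set" where
  "unit_square \<equiv> {0..1} \<times> {0..1}"

abbreviation unit_cube :: "(real \<times> real \<times> real) set" where
  "unit_cube \<equiv> {0..1} \<times> {0..1} \<times> {0..1}"

text \<open>
  Graphons are total functions on the plane, constrained only on the unit square; all functionals
  below integrate over the unit square or cube, so values elsewhere are irrelevant.
  Measurable means Borel measurable.
\<close>

definition graphon :: "(real \<times> real \<Rightarrow> real) \<Rightarrow> bool" where
  "graphon g \<longleftrightarrow>
     g \<in> borel_measurable (restrict_space borel unit_square) \<and>
     (\<forall>x\<in>{0..1}. \<forall>y\<in>{0..1}. g (x, y) = g (y, x)) \<and>
     (\<forall>p\<in>unit_square. g p \<in> {0..1})"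

definition edge_density :: "(real \<times> real \<Rightarrow> real) \<Rightarrow> real" where
  "edge_density g = (LINT p:unit_square|lborel. g p)"

definition triangle_density :: "(real \<times> real \<Rightarrow> real) \<Rightarrow> real" where
  "triangle_density g =
     (LINT p:unit_cube|lborel. case p of (x, y, z) \<Rightarrow> g (x, y) * g (y, z) * g (z, x))"

text \<open>The convention \<open>0 ln 0 = 0\<close> is automatic, since \<open>ln\<close> is total and is multiplied by 0.\<close>

definition H :: "real \<Rightarrow> real" where
  "H u = - (u * ln u + (1 - u) * ln (1 - u))"

definition S :: "(real \<times> real \<Rightarrow> real) \<Rightarrow> real" where
  "S g = (LINT p:unit_square|lborel. H (g p))"

definition graphon_with_densities :: "real \<Rightarrow> real \<Rightarrow> (real \<times> real \<Rightarrow> real) \<Rightarrow> bool" where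
  "graphon_with_densities e t g \<longleftrightarrow>
     graphon g \<and> edge_density g = e \<and> triangle_density g = t"

text \<open>
  The informal definition omits a null set, namely the lines where a coordinate is 0, 1/2 or 1;
  here 0 is grouped with the lower half of the interval, and 1/2 and 1 with the upper half.
\<close>

definition bipodal :: "real \<Rightarrow> real \<Rightarrow> real \<times> real \<Rightarrow> real" where
  "bipodal e \<sigma> = (\<lambda>(x, y). if x < 1/2 \<longleftrightarrow> y < 1/2 then e - \<sigma> else e + \<sigma>)"

end

theory Submission
  imports Defs "HOL-Real_Asymp.Real_Asymp"
begin

text \<open>
  Write a competitor as \<open>e\<close> plus a small symmetric kernel of zero degree. Its triangle
  density is then \<open>e\<^sup>3\<close> plus the trace of the cube of the kernel, so the target
  \<open>e\<^sup>3 - \<sigma>\<^sup>3\<close> forces a negative eigenvalue of size about \<open>\<sigma>\<close>, and to second order the entropy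
  only sees the squared norm, at least \<open>\<sigma>\<^sup>2\<close>. Every kernel
  \<open>- \<sigma> \<phi>(x) \<phi>(y)\<close> with \<open>\<integral> \<phi> = 0\<close> and \<open>\<integral> \<phi>\<^sup>2 = 1\<close> ties at this order. The third order
  contributes a multiple of \<open>(\<integral> \<phi>\<^sup>3)\<^sup>2\<close>, which vanishes when \<open>\<phi>\<close> is symmetrically distributed. The bipodal graphon is
  the choice \<open>\<phi> = \<plusminus>1\<close>, and the decision falls at order \<open>\<sigma>\<^sup>4\<close>.

  At that order \<open>M = \<integral> \<phi>\<^sup>4\<close> matters, and it can be made large. The fourth derivative of \<open>H\<close> is
  negative and contributes \<open>H''''(e) M\<^sup>2 / 24\<close>, which favours \<open>M = 1\<close>. But once \<open>f = \<phi>\<^sup>2 - 1\<close> is not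
  zero, one can add \<open>c \<sigma>\<^sup>2 f(x) f(y)\<close>: this correlates with the square of the kernel, and so gains
  \<open>H'''(e) c (M - 1)\<^sup>2 / 2\<close> from the third derivative at the cost \<open>H''(e) c\<^sup>2 (M - 1)\<^sup>2 / 2\<close>. As \<open>f\<close> is
  orthogonal to \<open>1\<close> and to \<open>\<phi>\<close>, the edge density is unaffected and the triangle density changes only by
  \<open>O(\<sigma>\<^sup>6)\<close>, which a tiny change of the leading eigenvalue compensates exactly. Choosing the best \<open>c\<close>, the
  total beats the bipodal graphon for large \<open>M\<close> iff \<open>3 H'''(e)\<^sup>2 > H''(e) H''''(e)\<close>. With
  \<open>p = e (1 - e)\<close> this reads \<open>3 (1 - 4 p) > 2 - 6 p\<close>, that is \<open>p < 1/6\<close>; for \<open>e < 1/2\<close> this is exactly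
  \<open>e < (3 - sqrt 3) / 6\<close>.

  The simplest such \<open>\<phi>\<close> takes the values \<open>\<plusminus>sqrt M\<close> on sets of measure \<open>1 / (2 M)\<close> and \<open>0\<close> elsewhere, which
  gives a tripodal graphon. Its densities come from \<open>triangle_sum_orthogonal\<close>, its entropy from
  \<open>S_tripodal\<close>, and \<open>entropy_gain_limit\<close> computes the limit of the entropy difference divided by \<open>\<sigma>\<^sup>4\<close>.
\<close>

section \<open>Step graphons\<close>

text \<open>
  A partition of the unit interval into finitely many measurable pods, given by the index function
  \<open>pod\<close>. All functionals of a graphon that is constant on products of pods become finite sums weighted
  by the measures \<open>w\<close> of the pods.
\<close>

locale pods =
  fixes n :: nat and pod :: "real \<Rightarrow> nat" and w :: "nat \<Rightarrow> real"
  assumes pod_less: "\<And>x. x \<in> {0..1} \<Longrightarrow> pod x < n"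
    and sets_pod: "\<And>i. i < n \<Longrightarrow> {x \<in> {0..1}. pod x = i} \<in> sets borel"
    and measure_pod: "\<And>i. i < n \<Longrightarrow> measure lborel {x \<in> {0..1}. pod x = i} = w i"
begin

definition P :: "nat \<Rightarrow> real set" where "P i = {x \<in> {0..1}. pod x = i}"

lemma sets_P [measurable]: "i < n \<Longrightarrow> P i \<in> sets borel"
  using sets_pod by (simp add: P_def)

lemma emeasure_P:
  assumes "i < n"
  shows "emeasure lborel (P i) = ennreal (w i)"
proof -
  have "emeasure lborel (P i) \<le> emeasure lborel {0..1::real}"
    by (rule emeasure_mono) (auto simp: P_def)
  then have "emeasure lborel (P i) \<noteq> \<infinity>"
    by (auto simp: top_unique)
  then show ?thesis
    using measure_pod[OF assms] by (simp add: P_def emeasure_eq_ennreal_measure)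
qed

lemma weight_nonneg: "i < n \<Longrightarrow> 0 \<le> w i"
  using measure_pod by (metis measure_nonneg)

lemma emeasure_P_Times:
  fixes B :: "'b::euclidean_space set"
  assumes "i < n" "B \<in> sets borel" "emeasure lborel B = ennreal v"
  shows "emeasure lborel (P i \<times> B) = ennreal (w i * v)"
proof -
  have "emeasure (lborel \<Otimes>\<^sub>M lborel) (P i \<times> B) = emeasure lborel (P i) * emeasure lborel B"
    using assms by (intro lborel.emeasure_pair_measure_Times) auto
  then show ?thesis
    using assms by (simp add: lborel_prod emeasure_P ennreal_mult' weight_nonneg)
qed

lemma emeasure_P2: "i < n \<Longrightarrow> j < n \<Longrightarrow> emeasure lborel (P i \<times> P j) = ennreal (w i * w j)"
  by (simp add: emeasure_P_Times emeasure_P)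

lemma emeasure_P3:
  "i < n \<Longrightarrow> j < n \<Longrightarrow> k < n \<Longrightarrow>
    emeasure lborel (P i \<times> P j \<times> P k) = ennreal (w i * (w j * w k))"
  by (intro emeasure_P_Times emeasure_P2) (auto intro!: borel_Times)

lemma sum_indicator_P:
  assumes "x \<in> {0..1}"
  shows "(\<Sum>i<n. indicator (P i) x * f i) = (f (pod x) :: real)"
proof -
  have "(\<Sum>i<n. indicator (P i) x * f i) = (\<Sum>i<n. if pod x = i then f i else 0)"
    using assms by (intro sum.cong) (auto simp: P_def indicator_def)
  also have "\<dots> = f (pod x)"
    using pod_less[OF assms] by simp
  finally show ?thesis .
qed

text \<open>
  A step function as a combination of indicators of boxes; this gives both its measurability and its
  integral.
\<close>

lemma step_eq_sum:
  assumes "x \<in> {0..1}" "y \<in> {0..1}"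
  shows "F (pod x) (pod y) = (\<Sum>i<n. \<Sum>j<n. indicator (P i \<times> P j) (x, y) * (F i j :: real))"
proof -
  have "(\<Sum>i<n. \<Sum>j<n. indicator (P i \<times> P j) (x, y) * F i j)
      = (\<Sum>i<n. indicator (P i) x * (\<Sum>j<n. indicator (P j) y * F i j))"
    by (simp only: indicator_times fst_conv snd_conv sum_distrib_left mult.assoc)
  then show ?thesis
    using assms by (simp only: sum_indicator_P)
qed

lemma step3_eq_sum:
  assumes "x \<in> {0..1}" "y \<in> {0..1}" "z \<in> {0..1}"
  shows "F (pod x) (pod y) (pod z)
    = (\<Sum>i<n. \<Sum>j<n. \<Sum>k<n. indicator (P i \<times> P j \<times> P k) (x, y, z) * (F i j k :: real))"
proof -
  have "(\<Sum>i<n. \<Sum>j<n. \<Sum>k<n. indicator (P i \<times> P j \<times> P k) (x, y, z) * F i j k)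
      = (\<Sum>i<n. indicator (P i) x * (\<Sum>j<n. indicator (P j) y * (\<Sum>k<n. indicator (P k) z * F i j k)))"
    by (simp only: indicator_times fst_conv snd_conv sum_distrib_left mult.assoc)
  then show ?thesis
    using assms by (simp only: sum_indicator_P)
qed

lemma integral_step:
  "(LINT p:unit_square|lborel. F (pod (fst p)) (pod (snd p)))
    = (\<Sum>i<n. \<Sum>j<n. w i * w j * (F i j :: real))"
proof -
  have "(LINT p:unit_square|lborel. F (pod (fst p)) (pod (snd p)))
      = (LINT p|lborel. (\<Sum>i<n. \<Sum>j<n. indicator (P i \<times> P j) p * F i j))"
    unfolding set_lebesgue_integral_def
  proof (rule Bochner_Integration.integral_cong[OF refl])
    fix p :: "real \<times> real"
    show "indicator unit_square p *\<^sub>R F (pod (fst p)) (pod (snd p))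
        = (\<Sum>i<n. \<Sum>j<n. indicator (P i \<times> P j) p * F i j)"
    proof (cases "p \<in> unit_square")
      case True
      then show ?thesis by (cases p) (simp add: step_eq_sum)
    next
      case False
      then show ?thesis by (cases p) (auto simp: indicator_def P_def)
    qed
  qed
  also have "\<dots> = (\<Sum>i<n. \<Sum>j<n. measure lborel (P i \<times> P j) * F i j)"
    by (intro has_bochner_integral_integral_eq has_bochner_integral_sum
        has_bochner_integral_mult_left has_bochner_integral_real_indicator)
      (auto simp: emeasure_P2 intro!: borel_Times)
  also have "\<dots> = (\<Sum>i<n. \<Sum>j<n. w i * w j * F i j)"
    by (simp add: emeasure_P2 measure_def weight_nonneg)
  finally show ?thesis .
qed

lemma integral_step3:
  "(LINT p:unit_cube|lborel. F (pod (fst p)) (pod (fst (snd p))) (pod (snd (snd p))))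
    = (\<Sum>i<n. \<Sum>j<n. \<Sum>k<n. w i * (w j * w k) * (F i j k :: real))"
proof -
  have "(LINT p:unit_cube|lborel. F (pod (fst p)) (pod (fst (snd p))) (pod (snd (snd p))))
      = (LINT p|lborel. (\<Sum>i<n. \<Sum>j<n. \<Sum>k<n. indicator (P i \<times> P j \<times> P k) p * F i j k))"
    unfolding set_lebesgue_integral_def
  proof (rule Bochner_Integration.integral_cong[OF refl])
    fix p :: "real \<times> real \<times> real"
    show "indicator unit_cube p *\<^sub>R F (pod (fst p)) (pod (fst (snd p))) (pod (snd (snd p)))
        = (\<Sum>i<n. \<Sum>j<n. \<Sum>k<n. indicator (P i \<times> P j \<times> P k) p * F i j k)"
    proof (cases "p \<in> unit_cube")
      case True
      then show ?thesis by (cases p) (simp add: step3_eq_sum)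
    next
      case False
      then show ?thesis by (cases p) (auto simp: indicator_def P_def)
    qed
  qed
  also have "\<dots> = (\<Sum>i<n. \<Sum>j<n. \<Sum>k<n. measure lborel (P i \<times> P j \<times> P k) * F i j k)"
    by (intro has_bochner_integral_integral_eq has_bochner_integral_sum
        has_bochner_integral_mult_left has_bochner_integral_real_indicator)
      (auto simp: emeasure_P3 intro!: borel_Times)
  also have "\<dots> = (\<Sum>i<n. \<Sum>j<n. \<Sum>k<n. w i * (w j * w k) * F i j k)"
    by (simp add: emeasure_P3 measure_def weight_nonneg)
  finally show ?thesis .
qed

definition step :: "(nat \<Rightarrow> nat \<Rightarrow> real) \<Rightarrow> real \<times> real \<Rightarrow> real" where
  "step G = (\<lambda>(x, y). G (pod x) (pod y))"

lemma edge_density_step: "edge_density (step G) = (\<Sum>i<n. \<Sum>j<n. w i * w j * G i j)"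
  using integral_step[of G] by (simp add: edge_density_def step_def case_prod_beta)

lemma S_step: "S (step G) = (\<Sum>i<n. \<Sum>j<n. w i * w j * H (G i j))"
  using integral_step[of "\<lambda>i j. H (G i j)"] by (simp add: S_def step_def case_prod_beta)

lemma triangle_density_step:
  "triangle_density (step G)
    = (\<Sum>i<n. \<Sum>j<n. \<Sum>k<n. w i * (w j * w k) * (G i j * G j k * G k i))"
  using integral_step3[of "\<lambda>i j k. G i j * G j k * G k i"]
  by (simp add: triangle_density_def step_def case_prod_beta)

lemma graphon_step:
  assumes "\<And>i j. i < n \<Longrightarrow> j < n \<Longrightarrow> G i j = G j i"
    and "\<And>i j. i < n \<Longrightarrow> j < n \<Longrightarrow> G i j \<in> {0..1}"
  shows "graphon (step G)"
  unfolding graphon_def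
proof (intro conjI ballI)
  have "(\<lambda>p. \<Sum>i<n. \<Sum>j<n. indicator (P i \<times> P j) p * G i j)
      \<in> borel_measurable (restrict_space borel unit_square)"
    by (intro measurable_restrict_space1 borel_measurable_sum borel_measurable_times
        borel_measurable_indicator borel_measurable_const borel_Times sets_P) auto
  moreover have "step G p = (\<Sum>i<n. \<Sum>j<n. indicator (P i \<times> P j) p * G i j)"
    if "p \<in> space (restrict_space borel unit_square)" for p
    using that by (cases p) (simp add: step_def step_eq_sum space_restrict_space)
  ultimately show "step G \<in> borel_measurable (restrict_space borel unit_square)"
    by (subst measurable_cong) auto
next
  fix x y :: real
  assume "x \<in> {0..1}" "y \<in> {0..1}"
  then show "step G (x, y) = step G (y, x)"
    using assms(1) pod_less by (simp add: step_def)
next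
  fix p :: "real \<times> real"
  assume "p \<in> unit_square"
  then show "step G p \<in> {0..1}"
    using assms(2) pod_less by (cases p) (simp add: step_def)
qed

end

section \<open>The symmetric bipodal graphon\<close>

definition half :: "real \<Rightarrow> nat" where
  "half x = (if x < 1/2 then 0 else 1)"

text \<open>
  The value at the boundary point \<open>1/2\<close> agrees with the convention of \<open>bipodal\<close>, so that the two functions
  coincide everywhere and not just almost everywhere.
\<close>

interpretation bi: pods 2 half "\<lambda>_. 1/2"
proof
  have *: "{x \<in> {0..1}. half x = i} = (if i = 0 then {0..<1/2} else {1/2..1})" if "i < 2" for i
    using that by (auto simp: half_def split: if_splits)
  show "{x \<in> {0..1}. half x = i} \<in> sets borel" if "i < 2" for i
    using that by (simp only: *) auto
  show "measure lborel {x \<in> {0..1}. half x = i} = 1/2" if "i < 2" for i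
    using that by (simp only: *) auto
qed (auto simp: half_def)

lemma bipodal_eq_step: "bipodal e \<sigma> = bi.step (\<lambda>i j. if i = j then e - \<sigma> else e + \<sigma>)"
  by (auto simp: bipodal_def bi.step_def half_def fun_eq_iff)

lemma bipodal_densities:
  assumes "0 \<le> e - \<sigma>" "0 \<le> \<sigma>" "e + \<sigma> \<le> 1"
  shows "graphon_with_densities e (e ^ 3 - \<sigma> ^ 3) (bipodal e \<sigma>)"
  unfolding graphon_with_densities_def bipodal_eq_step
proof (intro conjI)
  show "graphon (bi.step (\<lambda>i j. if i = j then e - \<sigma> else e + \<sigma>))"
    using assms by (intro bi.graphon_step) auto
  show "edge_density (bi.step (\<lambda>i j. if i = j then e - \<sigma> else e + \<sigma>)) = e"
    by (simp add: bi.edge_density_step numeral_2_eq_2 field_simps)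
  show "triangle_density (bi.step (\<lambda>i j. if i = j then e - \<sigma> else e + \<sigma>)) = e ^ 3 - \<sigma> ^ 3"
    by (simp add: bi.triangle_density_step numeral_2_eq_2) (simp add: field_simps power3_eq_cube)
qed

lemma S_bipodal: "S (bipodal e \<sigma>) = (H (e - \<sigma>) + H (e + \<sigma>)) / 2"
  unfolding bipodal_eq_step by (simp add: bi.S_step numeral_2_eq_2)

section \<open>Kernels diagonalized by an orthogonal family\<close>

text \<open>
  Composition of kernels in the span of an orthogonal family \<open>1\<close>, \<open>\<phi>\<close>, \<open>f\<close>: as functions of the
  integrated variable, two kernels are two such combinations, and all mixed terms of their inner
  product drop out.
\<close>

lemma sum_orthogonal:
  fixes w \<phi> f :: "'i \<Rightarrow> real"
  assumes "(\<Sum>i\<in>I. w i) = 1" "(\<Sum>i\<in>I. w i * \<phi> i) = 0" "(\<Sum>i\<in>I. w i * f i) = 0"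
    and "(\<Sum>i\<in>I. w i * (\<phi> i * \<phi> i)) = 1" "(\<Sum>i\<in>I. w i * (\<phi> i * f i)) = 0"
    and "(\<Sum>i\<in>I. w i * (f i * f i)) = v"
  shows "(\<Sum>i\<in>I. w i * ((a + b * \<phi> i + c * f i) * (a' + b' * \<phi> i + c' * f i)))
    = a * a' + b * b' + c * c' * v"
proof -
  have "(\<Sum>i\<in>I. w i * ((a + b * \<phi> i + c * f i) * (a' + b' * \<phi> i + c' * f i)))
    = (\<Sum>i\<in>I. a * a' * w i + (a * b' + b * a') * (w i * \<phi> i) + (a * c' + c * a') * (w i * f i)
        + b * b' * (w i * (\<phi> i * \<phi> i)) + (b * c' + c * b') * (w i * (\<phi> i * f i))
        + c * c' * (w i * (f i * f i)))"
    by (intro sum.cong refl) algebra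
  also have "\<dots> = a * a' + b * b' + c * c' * v"
    unfolding sum.distrib sum_distrib_left[symmetric] assms by simp
  finally show ?thesis .
qed

text \<open>
  The triangle sum is the trace of the cube of the kernel. The orthogonal functions \<open>1\<close>, \<open>\<phi>\<close>, \<open>f\<close> are
  eigenfunctions for \<open>a\<close>, \<open>b\<close> and \<open>c * v\<close>.
\<close>

lemma triangle_sum_orthogonal:
  fixes w \<phi> f :: "'i \<Rightarrow> real"
  assumes "(\<Sum>i\<in>I. w i) = 1" "(\<Sum>i\<in>I. w i * \<phi> i) = 0" "(\<Sum>i\<in>I. w i * f i) = 0"
    and "(\<Sum>i\<in>I. w i * (\<phi> i * \<phi> i)) = 1" "(\<Sum>i\<in>I. w i * (\<phi> i * f i)) = 0"
    and "(\<Sum>i\<in>I. w i * (f i * f i)) = v"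
  defines "K \<equiv> \<lambda>a b c i j. a + b * (\<phi> i * \<phi> j) + c * (f i * f j)"
  shows "(\<Sum>i\<in>I. \<Sum>j\<in>I. \<Sum>k\<in>I. w i * (w j * w k) * (K a b c i j * K a b c j k * K a b c k i))
    = a ^ 3 + b ^ 3 + (c * v) ^ 3"
proof -
  note orth = sum_orthogonal[OF assms(1-6)]
  have comp: "(\<Sum>k\<in>I. w k * (K a b c j k * K a' b' c' k i)) = K (a * a') (b * b') (c * c' * v) j i"
    for a b c a' b' c' i j
    using orth[of a "b * \<phi> j" "c * f j" a' "b' * \<phi> i" "c' * f i"]
    by (simp add: K_def algebra_simps)
  have "(\<Sum>i\<in>I. \<Sum>j\<in>I. \<Sum>k\<in>I. w i * (w j * w k) * (K a b c i j * K a b c j k * K a b c k i))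
      = (\<Sum>i\<in>I. w i * (\<Sum>j\<in>I. w j * (K a b c i j * (\<Sum>k\<in>I. w k * (K a b c j k * K a b c k i)))))"
    by (simp add: sum_distrib_left mult_ac)
  also have "\<dots> = (\<Sum>i\<in>I. w i * K (a * (a * a)) (b * (b * b)) (c * (c * c * v) * v) i i)"
    by (simp only: comp)
  also have "\<dots> = (\<Sum>i\<in>I. a ^ 3 * w i + b ^ 3 * (w i * (\<phi> i * \<phi> i))
      + c ^ 3 * v\<^sup>2 * (w i * (f i * f i)))"
    by (intro sum.cong refl) (simp add: K_def algebra_simps power2_eq_square power3_eq_cube)
  also have "\<dots> = a ^ 3 + b ^ 3 + (c * v) ^ 3"
    unfolding sum.distrib sum_distrib_left[symmetric] assms(1-6)
    by (simp add: power2_eq_square power3_eq_cube)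
  finally show ?thesis .
qed

section \<open>A tripodal competitor\<close>

definition tri_pod :: "real \<Rightarrow> real \<Rightarrow> nat" where
  "tri_pod M x = (if x < 1 / (2 * M) then 0 else if x < 1 / M then 1 else 2)"

definition tri_weight :: "real \<Rightarrow> nat \<Rightarrow> real" where
  "tri_weight M i = (if i < 2 then 1 / (2 * M) else 1 - 1 / M)"

text \<open>
  With the weights above, \<open>\<phi>\<close> has moments \<open>0\<close>, \<open>1\<close>, \<open>0\<close>, \<open>M\<close> of order one to four.
\<close>

definition phi :: "real \<Rightarrow> nat \<Rightarrow> real" where
  "phi M i = (if i = 0 then sqrt M else if i = 1 then - sqrt M else 0)"

text \<open>
  The diagonalized kernel \<open>e - s \<phi> \<phi> + b f f\<close> with \<open>f = \<phi>\<^sup>2 - 1\<close>. The squared norm of \<open>f\<close> is \<open>M - 1\<close>, so the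
  eigenvalues are \<open>e\<close>, \<open>- s\<close> and \<open>b (M - 1)\<close>.
\<close>

definition tri_value :: "real \<Rightarrow> real \<Rightarrow> real \<Rightarrow> real \<Rightarrow> nat \<Rightarrow> nat \<Rightarrow> real" where
  "tri_value M e s b i j
    = e - s * (phi M i * phi M j) + b * (((phi M i)\<^sup>2 - 1) * ((phi M j)\<^sup>2 - 1))"

definition tripodal :: "real \<Rightarrow> real \<Rightarrow> real \<Rightarrow> real \<Rightarrow> real \<times> real \<Rightarrow> real" where
  "tripodal M e s b = (\<lambda>(x, y). tri_value M e s b (tri_pod M x) (tri_pod M y))"

lemma pods_tri:
  assumes "1 < M"
  shows "pods 3 (tri_pod M) (tri_weight M)"
proof
  define a where "a = 1 / (2 * M)"
  have M: "0 < a" "2 * a < 1"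
    using assms by (auto simp: a_def field_simps)
  have pod: "tri_pod M x = (if x < a then 0 else if x < 2 * a then 1 else 2)" for x
    by (simp add: tri_pod_def a_def)
  have *: "{x \<in> {0..1}. tri_pod M x = i}
      = (if i = 0 then {0..<a} else if i = 1 then {a..<2 * a} else {2 * a..1})"
    if "i < 3" for i :: nat
    using that M by (auto simp: pod split: if_splits)
  show "{x \<in> {0..1}. tri_pod M x = i} \<in> sets borel" if "i < 3" for i
    using that by (simp only: *) auto
  have weight: "tri_weight M i = (if i < 2 then a else 1 - 2 * a)" for i
    by (simp add: tri_weight_def a_def)
  show "measure lborel {x \<in> {0..1}. tri_pod M x = i} = tri_weight M i" if "i < 3" for i
    using that M by (simp only: *) (auto simp: weight)
qed (auto simp: tri_pod_def)

lemma tripodal_eq_step: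
  "1 < M \<Longrightarrow> tripodal M e s b = pods.step (tri_pod M) (tri_value M e s b)"
  by (simp add: tripodal_def pods.step_def[OF pods_tri])

lemma tri_value_simps:
  assumes "1 < M"
  shows "tri_value M e s b 0 0 = e - s * M + b * (M - 1)\<^sup>2"
    "tri_value M e s b 0 1 = e + s * M + b * (M - 1)\<^sup>2"
    "tri_value M e s b 1 0 = e + s * M + b * (M - 1)\<^sup>2"
    "tri_value M e s b 1 1 = e - s * M + b * (M - 1)\<^sup>2"
    "tri_value M e s b 0 2 = e - b * (M - 1)" "tri_value M e s b 2 0 = e - b * (M - 1)"
    "tri_value M e s b 1 2 = e - b * (M - 1)" "tri_value M e s b 2 1 = e - b * (M - 1)"
    "tri_value M e s b 2 2 = e + b"
  using assms by (auto simp: tri_value_def phi_def power2_eq_square algebra_simps)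

lemma tri_weight_simps:
  "tri_weight M 0 = 1 / (2 * M)" "tri_weight M 1 = 1 / (2 * M)" "tri_weight M 2 = 1 - 1 / M"
  by (auto simp: tri_weight_def)

lemma sum_lessThan_3: "(\<Sum>i<3. f i) = f 0 + f 1 + (f 2 :: real)" for f :: "nat \<Rightarrow> real"
  by (simp add: numeral_3_eq_3 numeral_2_eq_2)

lemma S_tripodal:
  assumes "1 < M"
  shows "S (tripodal M e s b)
    = (H (e - s * M + b * (M - 1)\<^sup>2) + H (e + s * M + b * (M - 1)\<^sup>2)) / (2 * M\<^sup>2)
      + 2 * (M - 1) / M\<^sup>2 * H (e - b * (M - 1)) + (M - 1)\<^sup>2 / M\<^sup>2 * H (e + b)"
proof -
  have *: "1 - 1 / M = (M - 1) / M"
    using assms by (simp add: field_simps)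
  show ?thesis
    unfolding tripodal_eq_step[OF assms] pods.S_step[OF pods_tri[OF assms]] sum_lessThan_3
      tri_value_simps[OF assms] tri_weight_simps *
    using assms by (simp add: divide_simps power2_eq_square)
qed

lemma tripodal_densities:
  assumes "1 < M"
    and "e - s * M + b * (M - 1)\<^sup>2 \<in> {0..1}" "e + s * M + b * (M - 1)\<^sup>2 \<in> {0..1}"
    and "e - b * (M - 1) \<in> {0..1}" "e + b \<in> {0..1}"
  shows "graphon_with_densities e (e ^ 3 - s ^ 3 + (b * (M - 1)) ^ 3) (tripodal M e s b)"
  unfolding graphon_with_densities_def tripodal_eq_step[OF \<open>1 < M\<close>]
proof (intro conjI)
  have less3: "(i < 3) = (i = 0 \<or> i = 1 \<or> i = 2)" for i :: nat
    by auto
  have "tri_value M e s b i j \<in> {0..1}" if "i < 3" "j < 3" for i j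
    using that assms unfolding less3 by (elim disjE) (simp_all only: tri_value_simps)
  then show "graphon (pods.step (tri_pod M) (tri_value M e s b))"
    by (intro pods.graphon_step[OF pods_tri[OF \<open>1 < M\<close>]]) (auto simp: tri_value_def mult.commute)
  (* The three functions 1, phi, f are orthogonal for the weights of the pods, so that the edge and
     triangle densities can be read off from the eigenvalues. *)
  let ?w = "tri_weight M" and ?\<phi> = "phi M"
  let ?f = "\<lambda>i. (?\<phi> i)\<^sup>2 - 1"
  have "(\<Sum>i<3. ?w i) = 1" "(\<Sum>i<3. ?w i * ?\<phi> i) = 0" "(\<Sum>i<3. ?w i * ?f i) = 0"
    "(\<Sum>i<3. ?w i * (?\<phi> i * ?\<phi> i)) = 1" "(\<Sum>i<3. ?w i * (?\<phi> i * ?f i)) = 0"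
    "(\<Sum>i<3. ?w i * (?f i * ?f i)) = M - 1"
    using assms(1) unfolding sum_lessThan_3 tri_weight_simps phi_def
    by (simp_all add: field_simps power2_eq_square)
  note densities = sum_orthogonal[OF this, where a = e and a' = 1 and b' = 0 and c' = 0]
    triangle_sum_orthogonal[OF this, of e "- s" b]
  have kernel: "tri_value M e s b i j = e + - s * (?\<phi> i * ?\<phi> j) + b * (?f i * ?f j)" for i j
    by (simp add: tri_value_def)
  show "edge_density (pods.step (tri_pod M) (tri_value M e s b)) = e"
  proof -
    have "(\<Sum>i<3. \<Sum>j<3. ?w i * ?w j * tri_value M e s b i j) = (\<Sum>i<3. ?w i * e)"
    proof (rule sum.cong[OF refl])
      fix i
      have "(\<Sum>j<3. ?w i * ?w j * tri_value M e s b i j)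
          = ?w i * (\<Sum>j<3. ?w j * ((e + - s * ?\<phi> i * ?\<phi> j + b * ?f i * ?f j) * (1 + 0 * ?\<phi> j + 0 * ?f j)))"
        unfolding kernel sum_distrib_left by (simp only: mult.assoc mult_zero_left add_0_right mult_1_right)
      then show "(\<Sum>j<3. ?w i * ?w j * tri_value M e s b i j) = ?w i * e"
        unfolding densities(1) by simp
    qed
    then show ?thesis
      using \<open>(\<Sum>i<3. ?w i) = 1\<close>
      by (simp add: pods.edge_density_step[OF pods_tri[OF assms(1)]] flip: sum_distrib_right)
  qed
  show "triangle_density (pods.step (tri_pod M) (tri_value M e s b))
      = e ^ 3 - s ^ 3 + (b * (M - 1)) ^ 3"
    unfolding pods.triangle_density_step[OF pods_tri[OF assms(1)]] kernel densities(2)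
    by simp
qed

section \<open>Expansion of the entropy function\<close>

text \<open>
  The error of the fourth order Taylor polynomial of \<open>(1 + y) ln (1 + y)\<close>, relative to \<open>y\<^sup>4\<close>. Division by zero
  gives \<open>0\<close> at \<open>y = 0\<close>, which is the continuous extension.
\<close>

definition xlnx_rem :: "real \<Rightarrow> real" where
  "xlnx_rem y = ((1 + y) * ln (1 + y) - (y + y\<^sup>2 / 2 - y ^ 3 / 6 + y ^ 4 / 12)) / y ^ 4"

lemma isCont_xlnx_rem: "isCont xlnx_rem 0"
proof -
  have "(xlnx_rem \<longlongrightarrow> 0) (at 0)"
    unfolding xlnx_rem_def by real_asymp
  then show ?thesis
    by (simp add: isCont_def xlnx_rem_def)
qed

text \<open>
  Scaling \<open>x = a t\<close> reduces the expansion at \<open>a\<close> to the one at \<open>1\<close>, so that a single remainder function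
  without parameters serves both summands of \<open>H\<close>.
\<close>

lemma xlnx_expansion:
  assumes "0 < a" "0 < a + x"
  shows "(a + x) * ln (a + x) = a * ln a + (ln a + 1) * x + x\<^sup>2 / (2 * a) - x ^ 3 / (6 * a\<^sup>2)
    + x ^ 4 / (12 * a ^ 3) + x ^ 4 * (xlnx_rem (x / a) / a ^ 3)"
proof (cases "x = 0")
  case False
  define t where "t = x / a"
  have t: "x = a * t" "t \<noteq> 0"
    using False assms(1) by (auto simp: t_def)
  have "a + x = a * (1 + t)" "0 < 1 + t"
    using assms by (auto simp: t_def field_simps)
  then have ln: "ln (a + x) = ln a + ln (1 + t)"
    using assms by (metis ln_mult_pos)
  have scale: "x\<^sup>2 / (2 * a) = a * (t\<^sup>2 / 2)" "x ^ 3 / (6 * a\<^sup>2) = a * (t ^ 3 / 6)"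
    "x ^ 4 / (12 * a ^ 3) = a * (t ^ 4 / 12)" "x ^ 4 / a ^ 3 = a * t ^ 4"
    using assms(1) unfolding t(1) by (simp_all add: divide_simps) algebra+
  have "x ^ 4 * (xlnx_rem t / a ^ 3) = x ^ 4 / a ^ 3 * xlnx_rem t"
    by simp
  also have "\<dots> = a * ((1 + t) * ln (1 + t) - (t + t\<^sup>2 / 2 - t ^ 3 / 6 + t ^ 4 / 12))"
    using t(2) unfolding scale xlnx_rem_def by simp
  finally have "x ^ 4 * (xlnx_rem t / a ^ 3)
      = a * ((1 + t) * ln (1 + t) - (t + t\<^sup>2 / 2 - t ^ 3 / 6 + t ^ 4 / 12))" .
  then show ?thesis
    unfolding t_def[symmetric] ln scale unfolding t(1) by (simp add: algebra_simps)
qed simp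

text \<open>
  Taylor expansion with Peano remainder. The second, third and fourth derivatives of \<open>H\<close> at \<open>e\<close> are
  \<open>- 1 / p\<close>, \<open>(1 - 2 e) / p\<^sup>2\<close> and \<open>- 2 (1 - 3 p) / p\<^sup>3\<close>.
\<close>

lemma H_expansion:
  assumes "0 < e" "e < 1"
  defines "p \<equiv> e * (1 - e)"
  obtains R where "isCont R 0" "R 0 = 0"
    "\<And>x. 0 < e + x \<Longrightarrow> e + x < 1 \<Longrightarrow>
      H (e + x) = H e + (ln (1 - e) - ln e) * x - 1 / (2 * p) * x\<^sup>2 + (1 - 2 * e) / (6 * p\<^sup>2) * x ^ 3
        - (1 - 3 * p) / (12 * p ^ 3) * x ^ 4 + x ^ 4 * R x"
proof
  let ?R = "\<lambda>x. - (xlnx_rem (x / e) / e ^ 3 + xlnx_rem (- x / (1 - e)) / (1 - e) ^ 3)"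
  have "isCont (\<lambda>x. x / e) 0" "isCont (\<lambda>x. - x / (1 - e)) 0"
    using assms(1,2) by (intro continuous_intros; simp)+
  then have "isCont (\<lambda>x. xlnx_rem (x / e)) 0" "isCont (\<lambda>x. xlnx_rem (- x / (1 - e))) 0"
    using isCont_xlnx_rem by (auto intro: isCont_o2[where g = xlnx_rem])
  then show "isCont ?R 0"
    using assms(1,2) by (intro continuous_intros) auto
  show "?R 0 = 0"
    by (simp add: xlnx_rem_def)
  fix x
  assume x: "0 < e + x" "e + x < 1"
  have xlnx: "(e + x) * ln (e + x) = e * ln e + (ln e + 1) * x + x\<^sup>2 / (2 * e)
      - x ^ 3 / (6 * e\<^sup>2) + x ^ 4 / (12 * e ^ 3) + x ^ 4 * (xlnx_rem (x / e) / e ^ 3)"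
    "(1 - e + - x) * ln (1 - e + - x) = (1 - e) * ln (1 - e) - (ln (1 - e) + 1) * x
      + x\<^sup>2 / (2 * (1 - e)) + x ^ 3 / (6 * (1 - e)\<^sup>2) + x ^ 4 / (12 * (1 - e) ^ 3)
      + x ^ 4 * (xlnx_rem (- x / (1 - e)) / (1 - e) ^ 3)"
    using x assms(1,2) xlnx_expansion[of e x] xlnx_expansion[of "1 - e" "- x"] by simp_all
  have "H (e + x) = - ((e + x) * ln (e + x) + (1 - e + - x) * ln (1 - e + - x))"
    by (simp add: H_def algebra_simps)
  also have "\<dots> = H e + (ln (1 - e) - ln e) * x - (x\<^sup>2 / (2 * e) + x\<^sup>2 / (2 * (1 - e)))
      + (x ^ 3 / (6 * e\<^sup>2) - x ^ 3 / (6 * (1 - e)\<^sup>2))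
      - (x ^ 4 / (12 * e ^ 3) + x ^ 4 / (12 * (1 - e) ^ 3)) + x ^ 4 * ?R x"
    unfolding xlnx H_def by (simp only: ring_distribs minus_add_distrib mult_minus_right)
  also have "x\<^sup>2 / (2 * e) + x\<^sup>2 / (2 * (1 - e)) = 1 / (2 * p) * x\<^sup>2"
    using assms(1,2) by (simp add: p_def divide_simps) algebra
  also have "x ^ 3 / (6 * e\<^sup>2) - x ^ 3 / (6 * (1 - e)\<^sup>2) = (1 - 2 * e) / (6 * p\<^sup>2) * x ^ 3"
    using assms(1,2) by (simp add: p_def divide_simps) algebra
  also have "x ^ 4 / (12 * e ^ 3) + x ^ 4 / (12 * (1 - e) ^ 3) = (1 - 3 * p) / (12 * p ^ 3) * x ^ 4"
    using assms(1,2) by (simp add: p_def divide_simps) algebra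
  finally show "H (e + x) = H e + (ln (1 - e) - ln e) * x - 1 / (2 * p) * x\<^sup>2
      + (1 - 2 * e) / (6 * p\<^sup>2) * x ^ 3 - (1 - 3 * p) / (12 * p ^ 3) * x ^ 4 + x ^ 4 * ?R x" .
qed

section \<open>Comparison to fourth order\<close>

lemma eventually_perturbation_in_unit:
  fixes X :: "real \<Rightarrow> real"
  assumes "(X \<longlongrightarrow> l) (at_right 0)" "0 < e" "e < 1"
  shows "\<forall>\<^sub>F \<sigma> in at_right 0. e + \<sigma> * X \<sigma> \<in> {0<..<1}"
proof -
  have "((\<lambda>\<sigma>. e + \<sigma> * X \<sigma>) \<longlongrightarrow> e + 0 * l) (at_right 0)"
    by (intro tendsto_intros assms(1))
  then have "((\<lambda>\<sigma>. e + \<sigma> * X \<sigma>) \<longlongrightarrow> e) (at_right 0)"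
    by simp
  then show ?thesis
    using assms(2,3) by (auto intro: eventually_conj order_tendstoD)
qed

text \<open>
  Every value of the two graphons has the form \<open>e + \<sigma> X(\<sigma>)\<close> with \<open>X\<close> convergent. Hence its Taylor
  remainder, divided by \<open>\<sigma>\<^sup>4\<close>, vanishes in the limit.
\<close>

lemma tendsto_remainder:
  fixes X R :: "real \<Rightarrow> real"
  assumes "(X \<longlongrightarrow> l) (at_right 0)" "isCont R 0" "R 0 = 0"
  shows "((\<lambda>\<sigma>. X \<sigma> ^ 4 * R (\<sigma> * X \<sigma>)) \<longlongrightarrow> 0) (at_right 0)"
proof -
  have "((\<lambda>\<sigma>. \<sigma> * X \<sigma>) \<longlongrightarrow> 0 * l) (at_right 0)"
    by (intro tendsto_intros assms(1))
  then have "((\<lambda>\<sigma>. R (\<sigma> * X \<sigma>)) \<longlongrightarrow> R 0) (at_right 0)"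
    using isCont_tendsto_compose[OF assms(2)] by simp
  then have "((\<lambda>\<sigma>. X \<sigma> ^ 4 * R (\<sigma> * X \<sigma>)) \<longlongrightarrow> l ^ 4 * R 0) (at_right 0)"
    by (intro tendsto_intros assms(1))
  then show ?thesis
    by (simp add: assms(3))
qed

text \<open>
  The orders zero to three cancel because of the moments of \<open>\<phi>\<close> and \<open>f\<close>. What survives at order four
  are the quadratic and cubic effects of \<open>c \<sigma>\<^sup>2 f f\<close> and the excess \<open>M\<^sup>2 - 1\<close> of the fourth moment of the
  leading kernel. The factor \<open>\<omega>\<close> is the correction of the leading eigenvalue; the second condition on it
  says that it is too small to be felt through the second derivative of \<open>H\<close>.
\<close>

lemma entropy_gain_limit:
  fixes e M c :: real and \<omega> :: "real \<Rightarrow> real"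
  assumes "0 < e" "e < 1" "1 < M"
    and \<omega>: "(\<omega> \<longlongrightarrow> 1) (at_right 0)"
    and \<omega>2: "((\<lambda>\<sigma>. ((\<omega> \<sigma>)\<^sup>2 - 1) / \<sigma>\<^sup>2) \<longlongrightarrow> 0) (at_right 0)"
  defines "p \<equiv> e * (1 - e)"
  shows "((\<lambda>\<sigma>. (S (tripodal M e (\<sigma> * \<omega> \<sigma>) (c * \<sigma>\<^sup>2)) - S (bipodal e \<sigma>)) / \<sigma> ^ 4) \<longlongrightarrow>
      - 1 / (2 * p) * (c\<^sup>2 * (M - 1)\<^sup>2) + (1 - 2 * e) / (6 * p\<^sup>2) * (3 * c * (M - 1)\<^sup>2)
      - (1 - 3 * p) / (12 * p ^ 3) * (M\<^sup>2 - 1)) (at_right 0)"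
proof -
  obtain R where R: "isCont R 0" "R 0 = 0"
    and H: "\<And>x. 0 < e + x \<Longrightarrow> e + x < 1 \<Longrightarrow>
      H (e + x) = H e + (ln (1 - e) - ln e) * x - 1 / (2 * p) * x\<^sup>2 + (1 - 2 * e) / (6 * p\<^sup>2) * x ^ 3
        - (1 - 3 * p) / (12 * p ^ 3) * x ^ 4 + x ^ 4 * R x"
    using H_expansion[OF assms(1,2)] unfolding p_def by blast
  define h1 h2 h3 h4 where "h1 = ln (1 - e) - ln e" and "h2 = - 1 / (2 * p)"
    and "h3 = (1 - 2 * e) / (6 * p\<^sup>2)" and "h4 = - ((1 - 3 * p) / (12 * p ^ 3))"
  have H: "H (e + \<sigma> * x) = H e + h1 * \<sigma> * x + h2 * \<sigma>\<^sup>2 * x\<^sup>2 + h3 * \<sigma> ^ 3 * x ^ 3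
      + \<sigma> ^ 4 * (h4 * x ^ 4 + x ^ 4 * R (\<sigma> * x))" if "e + \<sigma> * x \<in> {0<..<1}" for \<sigma> x
    using that H[of "\<sigma> * x"]
    by (simp add: h1_def h2_def h3_def h4_def power_mult_distrib algebra_simps)
  (* The measures of the level sets of the tripodal graphon; its first two values share r1. *)
  define r1 r3 r4 where "r1 = 1 / (2 * M\<^sup>2)" and "r3 = 2 * (M - 1) / M\<^sup>2" and "r4 = (M - 1)\<^sup>2 / M\<^sup>2"
  have r1: "2 * r1 * M\<^sup>2 = 1"
    and r: "2 * r1 + r3 + r4 = 1" "2 * r1 * (M - 1)\<^sup>2 - r3 * (M - 1) + r4 = 0"
      "2 * r1 * (M - 1) ^ 4 + r3 * (M - 1)\<^sup>2 + r4 = (M - 1)\<^sup>2"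
    using assms(3) unfolding r1_def r3_def r4_def by (simp_all add: divide_simps) algebra+
  (* The deviations of the four values from e, divided by \<sigma>. *)
  define X1 X2 X3 X4 where "X1 = (\<lambda>\<sigma>. - \<omega> \<sigma> * M + c * \<sigma> * (M - 1)\<^sup>2)"
    and "X2 = (\<lambda>\<sigma>. \<omega> \<sigma> * M + c * \<sigma> * (M - 1)\<^sup>2)"
    and "X3 = (\<lambda>\<sigma>. - c * \<sigma> * (M - 1))" and "X4 = (\<lambda>\<sigma>. c * \<sigma>)"
  note X_def = X1_def X2_def X3_def X4_def
  (* The square of the third moment of f. *)
  define m where "m = 2 * r1 * (M - 1) ^ 6 - r3 * (M - 1) ^ 3 + r4"
  have moments: "r1 * (X1 \<sigma> + X2 \<sigma>) + r3 * X3 \<sigma> + r4 * X4 \<sigma> = 0"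
    "r1 * ((X1 \<sigma>)\<^sup>2 + (X2 \<sigma>)\<^sup>2) + r3 * (X3 \<sigma>)\<^sup>2 + r4 * (X4 \<sigma>)\<^sup>2 = (\<omega> \<sigma>)\<^sup>2 + c\<^sup>2 * \<sigma>\<^sup>2 * (M - 1)\<^sup>2"
    "r1 * (X1 \<sigma> ^ 3 + X2 \<sigma> ^ 3) + r3 * X3 \<sigma> ^ 3 + r4 * X4 \<sigma> ^ 3
      = 3 * (\<omega> \<sigma>)\<^sup>2 * c * \<sigma> * (M - 1)\<^sup>2 + c ^ 3 * \<sigma> ^ 3 * m" for \<sigma>
    using r1 r unfolding X_def m_def by algebra+
  have X: "(X1 \<longlongrightarrow> - M) (at_right 0)" "(X2 \<longlongrightarrow> M) (at_right 0)"
    "(X3 \<longlongrightarrow> 0) (at_right 0)" "(X4 \<longlongrightarrow> 0) (at_right 0)"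
    unfolding X_def by (auto intro!: tendsto_eq_intros \<omega>)
  (* The entropy difference divided by \<sigma>^4. The two bipodal values are treated as X = -1 and X = 1, so
     that their remainders have the same shape as the others. *)
  define Q where "Q = (\<lambda>\<sigma>. h2 * (((\<omega> \<sigma>)\<^sup>2 - 1) / \<sigma>\<^sup>2 + c\<^sup>2 * (M - 1)\<^sup>2)
    + h3 * (3 * (\<omega> \<sigma>)\<^sup>2 * c * (M - 1)\<^sup>2 + c ^ 3 * \<sigma>\<^sup>2 * m)
    + h4 * (r1 * (X1 \<sigma> ^ 4 + X2 \<sigma> ^ 4) + r3 * X3 \<sigma> ^ 4 + r4 * X4 \<sigma> ^ 4 - 1)
    + (r1 * (X1 \<sigma> ^ 4 * R (\<sigma> * X1 \<sigma>) + X2 \<sigma> ^ 4 * R (\<sigma> * X2 \<sigma>))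
      + r3 * (X3 \<sigma> ^ 4 * R (\<sigma> * X3 \<sigma>)) + r4 * (X4 \<sigma> ^ 4 * R (\<sigma> * X4 \<sigma>))
      - ((- 1) ^ 4 * R (\<sigma> * - 1) + 1 ^ 4 * R (\<sigma> * 1)) / 2))"
  have "(Q \<longlongrightarrow> h2 * (0 + c\<^sup>2 * (M - 1)\<^sup>2) + h3 * (3 * 1\<^sup>2 * c * (M - 1)\<^sup>2 + c ^ 3 * 0\<^sup>2 * m)
      + h4 * (r1 * ((- M) ^ 4 + M ^ 4) + r3 * 0 ^ 4 + r4 * 0 ^ 4 - 1)
      + (r1 * (0 + 0) + r3 * 0 + r4 * 0 - (0 + 0) / 2)) (at_right 0)"
    unfolding Q_def
    by (intro tendsto_intros \<omega> \<omega>2 X X[THEN tendsto_remainder[OF _ R]]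
        tendsto_remainder[OF tendsto_const R]) simp_all
  moreover have "r1 * ((- M) ^ 4 + M ^ 4) = M\<^sup>2"
    using r1 by algebra
  ultimately have lim: "(Q \<longlongrightarrow> h2 * (c\<^sup>2 * (M - 1)\<^sup>2) + h3 * (3 * c * (M - 1)\<^sup>2) + h4 * (M\<^sup>2 - 1)) (at_right 0)"
    by simp
  have "\<forall>\<^sub>F \<sigma> in at_right 0.
      (S (tripodal M e (\<sigma> * \<omega> \<sigma>) (c * \<sigma>\<^sup>2)) - S (bipodal e \<sigma>)) / \<sigma> ^ 4 = Q \<sigma>"
    using eventually_at_right_less[of 0]
      X[THEN eventually_perturbation_in_unit[OF _ assms(1,2)]]
      tendsto_const[of 1, THEN eventually_perturbation_in_unit[OF _ assms(1,2)]]
      tendsto_const[of "- 1", THEN eventually_perturbation_in_unit[OF _ assms(1,2)]]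
  proof eventually_elim
    case (elim \<sigma>)
    have "S (tripodal M e (\<sigma> * \<omega> \<sigma>) (c * \<sigma>\<^sup>2)) = r1 * (H (e + \<sigma> * X1 \<sigma>) + H (e + \<sigma> * X2 \<sigma>))
        + r3 * H (e + \<sigma> * X3 \<sigma>) + r4 * H (e + \<sigma> * X4 \<sigma>)"
      using assms(3) unfolding S_tripodal[OF assms(3)]
      by (simp add: r1_def r3_def r4_def X_def algebra_simps power2_eq_square add_divide_distrib)
    also have "\<dots> = H e * (2 * r1 + r3 + r4)
        + h1 * \<sigma> * (r1 * (X1 \<sigma> + X2 \<sigma>) + r3 * X3 \<sigma> + r4 * X4 \<sigma>)
        + h2 * \<sigma>\<^sup>2 * (r1 * ((X1 \<sigma>)\<^sup>2 + (X2 \<sigma>)\<^sup>2) + r3 * (X3 \<sigma>)\<^sup>2 + r4 * (X4 \<sigma>)\<^sup>2)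
        + h3 * \<sigma> ^ 3 * (r1 * (X1 \<sigma> ^ 3 + X2 \<sigma> ^ 3) + r3 * X3 \<sigma> ^ 3 + r4 * X4 \<sigma> ^ 3)
        + \<sigma> ^ 4 * (h4 * (r1 * (X1 \<sigma> ^ 4 + X2 \<sigma> ^ 4) + r3 * X3 \<sigma> ^ 4 + r4 * X4 \<sigma> ^ 4)
          + (r1 * (X1 \<sigma> ^ 4 * R (\<sigma> * X1 \<sigma>) + X2 \<sigma> ^ 4 * R (\<sigma> * X2 \<sigma>))
            + r3 * (X3 \<sigma> ^ 4 * R (\<sigma> * X3 \<sigma>)) + r4 * (X4 \<sigma> ^ 4 * R (\<sigma> * X4 \<sigma>))))"
      unfolding elim(2-5)[THEN H] by (simp only: ring_distribs mult_ac add_ac)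
    finally have "S (tripodal M e (\<sigma> * \<omega> \<sigma>) (c * \<sigma>\<^sup>2)) = \<dots>" .
    note tri = this[unfolded r(1) moments]
    define B where "B = ((- 1) ^ 4 * R (\<sigma> * - 1) + 1 ^ 4 * R (\<sigma> * 1)) / 2"
    have bi: "S (bipodal e \<sigma>) = H e + h2 * \<sigma>\<^sup>2 + \<sigma> ^ 4 * (h4 + B)"
      using H[OF elim(6)] H[OF elim(7)] by (simp add: S_bipodal B_def field_simps)
    have "\<sigma>\<^sup>2 * ((\<omega> \<sigma>)\<^sup>2 - 1) = \<sigma> ^ 4 * (((\<omega> \<sigma>)\<^sup>2 - 1) / \<sigma>\<^sup>2)"
      using elim(1) by (simp add: field_simps eval_nat_numeral)
    then have "S (tripodal M e (\<sigma> * \<omega> \<sigma>) (c * \<sigma>\<^sup>2)) - S (bipodal e \<sigma>) = \<sigma> ^ 4 * Q \<sigma>"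
      unfolding tri bi Q_def B_def[symmetric] by algebra
    then show ?case
      using elim(1) by simp
  qed
  then have "((\<lambda>\<sigma>. (S (tripodal M e (\<sigma> * \<omega> \<sigma>) (c * \<sigma>\<^sup>2)) - S (bipodal e \<sigma>)) / \<sigma> ^ 4) \<longlongrightarrow>
      h2 * (c\<^sup>2 * (M - 1)\<^sup>2) + h3 * (3 * c * (M - 1)\<^sup>2) + h4 * (M\<^sup>2 - 1)) (at_right 0)"
    using lim by (subst tendsto_cong)
  then show ?thesis
    by (simp add: h2_def h3_def h4_def)
qed

theorem theorem3:
  fixes e :: real
  assumes "0 < e" and "e < (3 - sqrt 3) / 6"
  shows "\<exists>\<sigma>\<^sub>0>0. \<forall>\<sigma>\<in>{0<..<\<sigma>\<^sub>0}.
           graphon_with_densities e (e ^ 3 - \<sigma> ^ 3) (bipodal e \<sigma>) \<and>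
           \<not> is_arg_max S (graphon_with_densities e (e ^ 3 - \<sigma> ^ 3)) (bipodal e \<sigma>)"
proof -
  define p where "p = e * (1 - e)"
  have "sqrt 3 < 3 - 6 * e"
    using assms(2) by simp
  then have "(sqrt 3)\<^sup>2 < (3 - 6 * e)\<^sup>2"
    by (intro power_strict_mono) auto
  then have p6: "6 * p < 1"
    by (simp add: p_def power2_eq_square algebra_simps)
  have e1: "e < 1"
    using \<open>sqrt 3 < 3 - 6 * e\<close> real_sqrt_ge_zero[of 3] by linarith
  have p0: "0 < p"
    using assms(1) e1 by (simp add: p_def)
  (* This c maximizes the quadratic polynomial of the limit. With it the sign of the limit is that of
     M (1 - 6 p) - (5 - 18 p), and M is chosen so that this equals 1 - 6 p. *)
  define M c where "M = 6 * (1 - 4 * p) / (1 - 6 * p)" and "c = (1 - 2 * e) / (2 * p)"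
  have M: "1 < M"
    using p6 by (simp add: M_def field_simps)
  (* Chosen so that (\<sigma> \<omega>)^3 = \<sigma>^3 + (c \<sigma>^2 (M - 1))^3: the leading eigenvalue absorbs the cube of the
     small positive one. *)
  define \<omega> where "\<omega> = (\<lambda>\<sigma>. root 3 (1 + (c * (M - 1)) ^ 3 * \<sigma> ^ 3))"
  have \<omega>: "(\<omega> \<longlongrightarrow> 1) (at_right 0)" "((\<lambda>\<sigma>. ((\<omega> \<sigma>)\<^sup>2 - 1) / \<sigma>\<^sup>2) \<longlongrightarrow> 0) (at_right 0)"
    unfolding \<omega>_def by real_asymp+
  have "- 1 / (2 * p) * (c\<^sup>2 * (M - 1)\<^sup>2) + (1 - 2 * e) / (6 * p\<^sup>2) * (3 * c * (M - 1)\<^sup>2)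
      - (1 - 3 * p) / (12 * p ^ 3) * (M\<^sup>2 - 1) > 0" (is "?\<kappa> > 0")
  proof -
    have sq: "(1 - 2 * e)\<^sup>2 = 1 - 4 * p"
      by (simp add: p_def power2_eq_square algebra_simps)
    have "?\<kappa> = (3 * (1 - 2 * e)\<^sup>2 * (M - 1)\<^sup>2 - 2 * (1 - 3 * p) * (M\<^sup>2 - 1)) / (24 * p ^ 3)"
      using p0 unfolding c_def by (simp add: divide_simps) algebra
    also have "\<dots> = (M - 1) * (M * (1 - 6 * p) - (5 - 18 * p)) / (24 * p ^ 3)"
      unfolding sq by (simp add: power2_eq_square algebra_simps)
    also have "M * (1 - 6 * p) - (5 - 18 * p) = 1 - 6 * p"
      using p6 by (simp add: M_def)
    finally show ?thesis
      using M p0 p6 by simp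
  qed
  then have "\<forall>\<^sub>F \<sigma> in at_right 0.
      0 < (S (tripodal M e (\<sigma> * \<omega> \<sigma>) (c * \<sigma>\<^sup>2)) - S (bipodal e \<sigma>)) / \<sigma> ^ 4"
    using order_tendstoD(1)[OF entropy_gain_limit[OF assms(1) e1 M \<omega>]] unfolding p_def by blast
  (* The values of both graphons are probabilities once \<sigma> is small. *)
  moreover have "((\<lambda>\<sigma>. - \<omega> \<sigma> * M + c * \<sigma> * (M - 1)\<^sup>2) \<longlongrightarrow> - 1 * M + c * 0 * (M - 1)\<^sup>2) (at_right 0)"
    "((\<lambda>\<sigma>. \<omega> \<sigma> * M + c * \<sigma> * (M - 1)\<^sup>2) \<longlongrightarrow> 1 * M + c * 0 * (M - 1)\<^sup>2) (at_right 0)"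
    "((\<lambda>\<sigma>. - c * \<sigma> * (M - 1)) \<longlongrightarrow> - c * 0 * (M - 1)) (at_right 0)"
    "((\<lambda>\<sigma>. c * \<sigma>) \<longlongrightarrow> c * 0) (at_right 0)"
    "((\<lambda>_. - 1) \<longlongrightarrow> (- 1 :: real)) (at_right 0)" "((\<lambda>_. 1) \<longlongrightarrow> (1 :: real)) (at_right 0)"
    by (intro tendsto_intros \<omega>)+
  note this[THEN eventually_perturbation_in_unit[OF _ assms(1) e1]]
  ultimately have "\<forall>\<^sub>F \<sigma> in at_right 0.
      graphon_with_densities e (e ^ 3 - \<sigma> ^ 3) (bipodal e \<sigma>) \<and>
      \<not> is_arg_max S (graphon_with_densities e (e ^ 3 - \<sigma> ^ 3)) (bipodal e \<sigma>)"
    using eventually_at_right_less[of 0]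
  proof eventually_elim
    case (elim \<sigma>)
    let ?s = "\<sigma> * \<omega> \<sigma>" and ?b = "c * \<sigma>\<^sup>2"
    have "graphon_with_densities e (e ^ 3 - ?s ^ 3 + (?b * (M - 1)) ^ 3) (tripodal M e ?s ?b)"
      using elim by (intro tripodal_densities[OF M]) (simp_all add: algebra_simps power2_eq_square)
    moreover have "\<omega> \<sigma> ^ 3 = 1 + (c * (M - 1)) ^ 3 * \<sigma> ^ 3"
      unfolding \<omega>_def by (rule odd_real_root_pow) simp
    then have "e ^ 3 - ?s ^ 3 + (?b * (M - 1)) ^ 3 = e ^ 3 - \<sigma> ^ 3"
      by algebra
    moreover have "S (bipodal e \<sigma>) < S (tripodal M e ?s ?b)"
      using elim by (simp add: zero_less_divide_iff)
    moreover have "graphon_with_densities e (e ^ 3 - \<sigma> ^ 3) (bipodal e \<sigma>)"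
      using elim by (intro bipodal_densities) simp_all
    ultimately show ?case
      by (auto simp: is_arg_max_def)
  qed
  then show ?thesis
    unfolding eventually_at_right[OF zero_less_one] by auto
qed

end
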